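(* Let $B\ge 1$, let $x_{\rm tr}\in\mathbb{C}^B\setminus\{0\}$ be a fixed training vector, let $\sigma_x^2,\sigma_w^2>0$, let $a,b>0$ be the constants associated with the digital modulation used, and let $h$ be a complex random variable (the fading coefficient of a flat-fading AWGN channel) with any given distribution. Then the MVU filter $f_{\rm MVU}=x_{\rm tr}/\|x_{\rm tr}\|^2$ is not an optimal channel estimator for the task of minimizing the average zeroth order error probability $\overline{[P_e]}_0(f)=E_h\big[[P_e]_0(f;h)\big]$; that is, $f_{\rm MVU}$ does not minimize $\overline{[P_e]}_0$ over $f\in\mathbb{C}^B\setminus\{0\}$.
   Context: A linear channel estimator is determined by a filter $f\in\mathbb{C}^B$ through $\hat h=f^Hy_{\rm tr}$, where $y_{\rm tr}=h\,x_{\rm tr}+w_{\rm tr}$ and $w_{\rm tr}\in\mathbb{C}^B$ has i.i.d. circularly symmetric complex Gaussian entries of mean $0$ and variance $\sigma_w^2$; data symbols have mean zero and power $\sigma_x^2$. For common modulations, the error probability in an AWGN channel is approximately $aQ(b\sqrt{\mathrm{SNR}})$, where $a,b>0$ depend on the constellation geometry and $Q(x)=\frac{1}{\sqrt{2\pi}}\int_x^{\infty}e^{-t^2/2}\,dt$. The zeroth order error probability for channel value $h$ is defined as $$[P_e]_0(f;h)=a\,Q\!\left(b\sqrt{\frac{|h|^2|f^Hx_{\rm tr}|^2+\sigma_w^2\|f\|^2}{\sigma_w^2/\sigma_x^2+|h|^2|f^Hx_{\rm tr}-1|^2+\sigma_w^2\|f\|^2}}\right).$$ $E_h$ denotes expectation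 over the distribution of $h$; the filter $f$ does not depend on the realization of $h$. *)

theory Defs
  imports "HOL-Probability.Probability"
begin

definition Q_function :: "real \<Rightarrow> real" where
  "Q_function x = 1 / sqrt (2 * pi) * (LBINT t:{x..}. exp (- t\<^sup>2 / 2))"

(* The Hermitian product f^H y, conjugate-linear in the filter f. The norm on
   complex ^ 'B is the Euclidean one, so it is the norm induced by this product. *)
definition herm :: "complex ^ 'B \<Rightarrow> complex ^ 'B \<Rightarrow> complex" where
  "herm f y = (\<Sum>i\<in>UNIV. cnj (f $ i) * y $ i)"

(* Here sx and sw are standard deviations: the symbol power is sx^2, the noise variance sw^2. *)
definition zeroth_order_SNR ::
  "real \<Rightarrow> real \<Rightarrow> complex ^ 'B \<Rightarrow> complex ^ 'B \<Rightarrow> complex \<Rightarrow> real" where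
  "zeroth_order_SNR sx sw xtr f h =
     ((cmod h)\<^sup>2 * (cmod (herm f xtr))\<^sup>2 + sw\<^sup>2 * (norm f)\<^sup>2) /
     (sw\<^sup>2 / sx\<^sup>2 + (cmod h)\<^sup>2 * (cmod (herm f xtr - 1))\<^sup>2 + sw\<^sup>2 * (norm f)\<^sup>2)"

definition zeroth_order_error ::
  "real \<Rightarrow> real \<Rightarrow> real \<Rightarrow> real \<Rightarrow> complex ^ 'B \<Rightarrow> complex ^ 'B \<Rightarrow> complex \<Rightarrow> real" where
  "zeroth_order_error a b sx sw xtr f h =
     a * Q_function (b * sqrt (zeroth_order_SNR sx sw xtr f h))"

(* For a > 0 and measurable h on a probability space the integrand is measurable with
   values in [0, a], so the Bochner integral is the genuine expectation. *)
definition average_zeroth_order_error ::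
  "'w measure \<Rightarrow> ('w \<Rightarrow> complex) \<Rightarrow> real \<Rightarrow> real \<Rightarrow> real \<Rightarrow> real
    \<Rightarrow> complex ^ 'B \<Rightarrow> complex ^ 'B \<Rightarrow> real" where
  "average_zeroth_order_error M h a b sx sw xtr f =
     (\<integral>\<omega>. zeroth_order_error a b sx sw xtr f (h \<omega>) \<partial>M)"

definition MVU_filter :: "complex ^ 'B \<Rightarrow> complex ^ 'B" where
  "MVU_filter xtr = xtr /\<^sub>R (norm xtr)\<^sup>2"

definition optimal_filter :: "(complex ^ 'B \<Rightarrow> real) \<Rightarrow> complex ^ 'B \<Rightarrow> bool" where
  "optimal_filter J f \<longleftrightarrow> f \<noteq> 0 \<and> (\<forall>g. g \<noteq> 0 \<longrightarrow> J f \<le> J g)"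

end

theory Submission
  imports Defs
begin

text \<open>
  Scaling the MVU filter by \<open>1 / (1 - d)\<close> with small \<open>d > 0\<close> lowers the average error.
  Put \<open>m = \<sigma>\<^sub>w\<^sup>2 / \<sigma>\<^sub>x\<^sup>2\<close>, \<open>k = \<sigma>\<^sub>w\<^sup>2 / \<parallel>x\<parallel>\<^sup>2\<close> and \<open>H = \<bar>h\<bar>\<^sup>2\<close>. The scaled filter has the
  SNR \<open>(H + k) / (m (1 - d)\<^sup>2 + H d\<^sup>2 + k)\<close>, which near \<open>d = 0\<close> grows linearly in \<open>d\<close>, uniformly
  for \<open>H\<close> in a bounded set of positive probability. The SNR falls below its value at
  \<open>d = 0\<close> only if \<open>H d > m\<close>; then it is at least of order \<open>1 / d\<close>, so the bound
  \<open>Q x \<le> 3 / x^4\<close> makes the loss \<open>O(d\<^sup>2)\<close>. Hence the linear gain wins for small \<open>d\<close>.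
\<close>

section \<open>The Gaussian tail function\<close>

lemma Q_function_eq: "Q_function x = (LBINT t:{x..}. std_normal_density t)"
  by (simp add: Q_function_def std_normal_density_def flip: set_integral_mult_right)

lemma set_integrable_std_normal_density:
  "A \<in> sets borel \<Longrightarrow> set_integrable lborel A std_normal_density"
  unfolding set_integrable_def using integrable_mult_indicator[of A lborel std_normal_density]
  by simp

lemma Q_function_diff:
  assumes "x \<le> y"
  shows "Q_function x = (LBINT t:{x..<y}. std_normal_density t) + Q_function y"
proof -
  have "{x..} = {x..<y} \<union> {y..}"
    using assms by auto
  then show ?thesis
    unfolding Q_function_eq
    by (simp only:, subst set_integral_Un)
       (auto intro: set_integrable_std_normal_density)
qed

text \<open>The density decreases on the nonnegative axis, so its integral over
  \<open>{x..<y}\<close> is at least the length times the value at the right end.\<close>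

lemma Q_function_diff_ge:
  assumes "0 \<le> x" "x \<le> y"
  shows "(y - x) * std_normal_density y \<le> Q_function x - Q_function y"
proof -
  have "(y - x) * std_normal_density y = (LBINT t:{x..<y}. std_normal_density y)"
    using assms by (simp add: set_integral_const)
  also have "\<dots> \<le> (LBINT t:{x..<y}. std_normal_density t)"
  proof (rule set_integral_mono)
    show "set_integrable lborel {x..<y} (\<lambda>t. std_normal_density y)"
      using assms by (simp add: set_integrable_def)
    show "std_normal_density y \<le> std_normal_density t" if "t \<in> {x..<y}" for t
      using that assms by (auto simp: std_normal_density_def intro!: divide_right_mono power_mono)
  qed (auto intro: set_integrable_std_normal_density)
  finally show ?thesis
    using Q_function_diff[OF assms(2)] by simp
qed

lemma Q_function_antimono: "x \<le> y \<Longrightarrow> Q_function y \<le> Q_function x"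
  using Q_function_diff[of x y]
  by (simp add: set_lebesgue_integral_def)

lemma Q_function_nonneg: "0 \<le> Q_function x"
  unfolding Q_function_eq set_lebesgue_integral_def by (intro Bochner_Integration.integral_nonneg) simp

lemma Q_function_le_1: "Q_function x \<le> 1"
proof -
  have "Q_function x \<le> (\<integral>t. std_normal_density t \<partial>lborel)"
    unfolding Q_function_eq set_lebesgue_integral_def
    by (intro integral_mono integrable_mult_indicator) (auto simp: indicator_def)
  then show ?thesis
    by simp
qed

text \<open>A Markov bound with the fourth moment, which is 3: the factor
  \<open>t ^ 4 / x ^ 4\<close> is at least 1 on the tail. For \<open>x\<close> of order
  \<open>1 / sqrt d\<close> it yields a bound of order \<open>d\<^sup>2\<close>; the second moment
  would yield only order \<open>d\<close>, too weak against a linear gain.\<close>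

lemma Q_function_le_inverse_power4:
  assumes "0 < x"
  shows "Q_function x \<le> 3 / x ^ 4"
proof -
  have "Q_function x \<le> (\<integral>t. std_normal_density t * t ^ 4 / x ^ 4 \<partial>lborel)"
    unfolding Q_function_eq set_lebesgue_integral_def
  proof (rule integral_mono)
    show "integrable lborel (\<lambda>t. indicator {x..} t *\<^sub>R std_normal_density t)"
      by (intro integrable_mult_indicator) auto
    show "integrable lborel (\<lambda>t. std_normal_density t * t ^ 4 / x ^ 4)"
      by (intro integrable_divide_zero integrable_std_normal_moment)
    show "indicator {x..} t *\<^sub>R std_normal_density t \<le> std_normal_density t * t ^ 4 / x ^ 4" for t
    proof (cases "x \<le> t")
      case True
      then have "std_normal_density t * x ^ 4 \<le> std_normal_density t * t ^ 4"
        using assms by (intro mult_left_mono power_mono) auto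
      then show ?thesis
        using assms True by (simp add: pos_le_divide_eq)
    qed (use assms in auto)
  qed
  also have "\<dots> = 3 / x ^ 4"
    using integral_std_normal_moment_even[of 2] by (simp add: fact_numeral)
  finally show ?thesis .
qed

lemma borel_measurable_Q_function [measurable]: "Q_function \<in> borel_measurable borel"
proof -
  have "(\<lambda>x. - Q_function x) \<in> borel_measurable borel"
    by (intro borel_measurable_mono) (auto simp: mono_def intro: Q_function_antimono)
  then show ?thesis
    by (simp add: borel_measurable_uminus_eq)
qed


section \<open>The SNR of a scaled MVU filter\<close>

text \<open>The fraction is expanded by \<open>(1 - d)\<^sup>2\<close>, so that \<open>d\<close>
  occurs in the denominator only. At \<open>d = 0\<close>, the MVU filter, the denominator is
  \<open>m + k\<close>.\<close>

definition scaled_SNR :: "real \<Rightarrow> real \<Rightarrow> real \<Rightarrow> real \<Rightarrow> real" where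
  "scaled_SNR m k H d = (H + k) / (m * (1 - d)\<^sup>2 + H * d\<^sup>2 + k)"

lemma herm_scaleR_self: "herm (c *\<^sub>R x) x = of_real (c * (norm x)\<^sup>2)"
  by (simp add: herm_def norm_vec_def L2_set_def sum_nonneg sum_distrib_left
        complex_norm_square scaleR_conv_of_real[where 'a = complex] mult_ac flip: of_real_power)

lemma zeroth_order_SNR_scaled_MVU:
  fixes x :: "complex ^ 'B"
  assumes "x \<noteq> 0" "d < 1"
  shows "zeroth_order_SNR sx sw x (MVU_filter x /\<^sub>R (1 - d)) h =
    scaled_SNR (sw\<^sup>2 / sx\<^sup>2) (sw\<^sup>2 / (norm x)\<^sup>2) ((cmod h)\<^sup>2) d"
proof -
  let ?f = "MVU_filter x /\<^sub>R (1 - d)" and ?H = "(cmod h)\<^sup>2"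
  let ?N = "?H + sw\<^sup>2 / (norm x)\<^sup>2"
  let ?D = "sw\<^sup>2 / sx\<^sup>2 * (1 - d)\<^sup>2 + ?H * d\<^sup>2 + sw\<^sup>2 / (norm x)\<^sup>2"
  have *: "norm x > 0" "1 - d > 0"
    using assms by auto
  have f: "?f = (1 / ((1 - d) * (norm x)\<^sup>2)) *\<^sub>R x"
    by (simp add: MVU_filter_def divide_inverse)
  have herm: "herm ?f x = of_real (1 / (1 - d))"
    unfolding f herm_scaleR_self using * by simp
  have "herm ?f x - 1 = of_real (1 / (1 - d) - 1)"
    unfolding herm by simp
  also have "1 / (1 - d) - 1 = d / (1 - d)"
    using * by (simp add: field_simps)
  finally have herm1: "(cmod (herm ?f x - 1))\<^sup>2 = d\<^sup>2 / (1 - d)\<^sup>2"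
    by (simp only: norm_of_real power2_abs power_divide)
  have "norm ?f = 1 / ((1 - d) * norm x)"
    unfolding f using * by (simp add: power2_eq_square)
  then have norm: "(norm ?f)\<^sup>2 = 1 / ((norm x)\<^sup>2 * (1 - d)\<^sup>2)"
    by (simp add: power_divide power_mult_distrib mult.commute)
  have herm2: "(cmod (herm ?f x))\<^sup>2 = 1 / (1 - d)\<^sup>2"
    unfolding herm by (simp only: norm_of_real power2_abs power_divide power_one)
  have "zeroth_order_SNR sx sw x ?f h = (?N / (1 - d)\<^sup>2) / (?D / (1 - d)\<^sup>2)"
    unfolding zeroth_order_SNR_def herm1 herm2 norm
    using * by (intro arg_cong2[where f = "(/)"]) (simp_all add: add_divide_distrib)
  also have "\<dots> = ?N / ?D"
    using * by simp
  finally show ?thesis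
    by (simp add: scaled_SNR_def)
qed

context
  fixes m k :: real
  assumes m: "0 < m" and k: "0 < k"
begin

lemma scaled_SNR_denominator_ge:
  assumes "0 \<le> H"
  shows "k \<le> m * (1 - d)\<^sup>2 + H * d\<^sup>2 + k"
  using assms m by simp

lemma scaled_SNR_nonneg: "0 \<le> H \<Longrightarrow> 0 \<le> scaled_SNR m k H d"
  using k scaled_SNR_denominator_ge[of H d] by (simp add: scaled_SNR_def)

text \<open>The denominator is \<open>m + k - 2 * m * d + (m + H) * d\<^sup>2\<close>, and the
  smallness of \<open>d\<close> bounds the last term by \<open>m * d\<close>. So it drops by at
  least \<open>m * d\<close>, while the numerator is at least \<open>k\<close>.\<close>

lemma scaled_SNR_gain:
  assumes "0 \<le> H" "H \<le> R" "0 < d" "d * (m + R) \<le> m"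
  shows "scaled_SNR m k H 0 + k * m / (m + k)\<^sup>2 * d \<le> scaled_SNR m k H d"
proof -
  let ?D = "m * (1 - d)\<^sup>2 + H * d\<^sup>2 + k"
  have D: "0 < ?D"
    using scaled_SNR_denominator_ge[OF assms(1), of d] k by linarith
  have "(m + H) * d \<le> m"
    using order_trans[OF mult_left_mono[of "m + H" "m + R" d] assms(4)] assms
    by (simp add: mult.commute)
  then have "(m + H) * d * d \<le> m * d"
    using assms by (intro mult_right_mono) auto
  then have gap: "m * d \<le> m + k - ?D"
    by (simp add: power2_eq_square algebra_simps)
  then have "?D \<le> m + k"
    using m assms by (smt (verit) mult_pos_pos)
  then have "?D * (m + k) \<le> (m + k)\<^sup>2"
    using m k by (simp add: power2_eq_square)
  then have "k * m / (m + k)\<^sup>2 * d \<le> k * (m * d) / (?D * (m + k))"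
    using D m k assms by (auto intro!: divide_left_mono simp: mult_ac)
  also have "\<dots> \<le> (H + k) * (m + k - ?D) / (?D * (m + k))"
    using D m k assms gap by (intro divide_right_mono mult_mono) auto
  also have "\<dots> = scaled_SNR m k H d - scaled_SNR m k H 0"
  proof -
    have "N * (E - D) / (D * E) = N / D - N / E" if "D > 0" "E > 0" for N D E :: real
      using that by (simp add: field_simps)
    from this[of ?D "m + k" "H + k"] show ?thesis
      using D m k by (simp add: scaled_SNR_def)
  qed
  finally show ?thesis
    by simp
qed

text \<open>A smaller SNR means a larger denominator, which forces \<open>m < H * d\<close>. Then
  \<open>H * d\<close> dominates the denominator up to the factor \<open>(2 * m + k) / m\<close>,
  and comparing with the numerator \<open>H + k\<close> cancels \<open>H\<close>.\<close>

lemma scaled_SNR_loss: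
  assumes "0 \<le> H" "0 < d" "d < 1" "scaled_SNR m k H d < scaled_SNR m k H 0"
  shows "m / ((2 * m + k) * d) \<le> scaled_SNR m k H d"
proof -
  let ?D = "m * (1 - d)\<^sup>2 + H * d\<^sup>2 + k"
  have D: "0 < ?D"
    using scaled_SNR_denominator_ge[OF assms(1), of d] k by linarith
  have "m + k < ?D"
  proof (rule ccontr)
    assume "\<not> m + k < ?D"
    then have "(H + k) / (m + k) \<le> (H + k) / ?D"
      using assms k m D by (intro divide_left_mono) auto
    then show False
      using assms by (simp add: scaled_SNR_def)
  qed
  \<comment> \<open>Expand the square and cancel \<open>m + k\<close>.\<close>
  then have "d * (2 * m) < d * ((m + H) * d)"
    by (simp add: power2_eq_square algebra_simps)
  then have "2 * m < (m + H) * d"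
    using assms by simp
  moreover have md: "m * d < m"
    using assms m by simp
  ultimately have Hd: "m < H * d"
    by (simp add: algebra_simps)
  have "m * ?D \<le> m * (m + k + H * d)"
  proof (rule mult_left_mono)
    have "H * d\<^sup>2 \<le> H * d"
      using assms by (simp add: power2_eq_square mult_left_le mult_left_mono)
    have "m * (1 - d)\<^sup>2 \<le> m"
      using assms m by (simp add: mult_left_le power_le_one)
    then show "?D \<le> m + k + H * d"
      using \<open>H * d\<^sup>2 \<le> H * d\<close> by simp
  qed (use m in auto)
  also have "\<dots> \<le> (2 * m + k) * (H * d)"
    using mult_right_mono[OF less_imp_le[OF Hd], of "m + k"] m k by (simp add: algebra_simps)
  also have "\<dots> \<le> (H + k) * ((2 * m + k) * d)"
    using assms m k by (simp add: algebra_simps)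
  finally have cross: "m * ?D \<le> (H + k) * ((2 * m + k) * d)" .
  have "p / q \<le> r / s" if "p * s \<le> r * q" "0 < q" "0 < s" for p q r s :: real
    using that by (simp add: field_simps)
  from this[OF cross _ D] show ?thesis
    using m k assms by (simp add: scaled_SNR_def)
qed

text \<open>The linear SNR gain passes through the square root and then through
  \<open>Q_function\<close>. Bounding the SNR above keeps both slopes away from zero, so
  \<open>c\<close> depends neither on \<open>H\<close> nor on \<open>d\<close>.\<close>

lemma Q_scaled_SNR_gain:
  assumes "0 \<le> R" "0 < b"
  obtains c where "0 < c" and
    "\<And>H d. 0 \<le> H \<Longrightarrow> H \<le> R \<Longrightarrow> 0 < d \<Longrightarrow> d * (m + R) \<le> m \<Longrightarrow>
      Q_function (b * sqrt (scaled_SNR m k H d)) + c * d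
        \<le> Q_function (b * sqrt (scaled_SNR m k H 0))"
proof
  \<comment> \<open>A common bound for the SNRs: the numerator is at most \<open>R + k\<close>, the
    denominator at least \<open>k\<close>.\<close>
  define U where "U = (R + k) / k"
  \<comment> \<open>The SNR slope, divided by \<open>2 * sqrt U\<close> for the root, times
    \<open>b\<close> and the least density in the range.\<close>
  define c where "c = b * (k * m / (m + k)\<^sup>2 / (2 * sqrt U)) * std_normal_density (b * sqrt U)"
  have U: "0 < U"
    using assms k by (simp add: U_def)
  show "0 < c"
    using assms m k U by (simp add: c_def normal_density_pos)
  fix H d :: real
  assume H: "0 \<le> H" "H \<le> R" and d: "0 < d" "d * (m + R) \<le> m"
  let ?p = "scaled_SNR m k H d" and ?q = "scaled_SNR m k H 0"
  have p: "?q + k * m / (m + k)\<^sup>2 * d \<le> ?p"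
    by (rule scaled_SNR_gain[OF H d])
  have "?p \<le> U"
    unfolding scaled_SNR_def U_def
    using scaled_SNR_denominator_ge[OF H(1), of d] H k by (intro frac_le) auto
  have q0: "0 \<le> ?q"
    using scaled_SNR_nonneg[OF H(1)] .
  have "0 < k * m / (m + k)\<^sup>2 * d"
    using m k d by simp
  with p have qp: "?q \<le> ?p"
    by linarith
  have "?p - ?q = (sqrt ?p - sqrt ?q) * (sqrt ?p + sqrt ?q)"
    using qp q0 by (simp add: algebra_simps)
  also have "\<dots> \<le> (sqrt ?p - sqrt ?q) * (2 * sqrt U)"
  proof (rule mult_left_mono)
    have "sqrt ?p \<le> sqrt U" "sqrt ?q \<le> sqrt U"
      using qp \<open>?p \<le> U\<close> by simp_all
    then show "sqrt ?p + sqrt ?q \<le> 2 * sqrt U"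
      by linarith
  qed (use qp in simp)
  finally have "?p - ?q \<le> (sqrt ?p - sqrt ?q) * (2 * sqrt U)" .
  with p have "k * m / (m + k)\<^sup>2 * d \<le> (sqrt ?p - sqrt ?q) * (2 * sqrt U)"
    by linarith
  then have root_gain: "k * m / (m + k)\<^sup>2 / (2 * sqrt U) * d \<le> sqrt ?p - sqrt ?q"
    using pos_divide_le_eq[of "2 * sqrt U" "k * m / (m + k)\<^sup>2 * d" "sqrt ?p - sqrt ?q"] U by simp
  have density: "std_normal_density (b * sqrt U) \<le> std_normal_density (b * sqrt ?p)"
    using assms qp q0 \<open>?p \<le> U\<close> unfolding std_normal_density_def
    by (intro mult_left_mono) (auto simp: power_mult_distrib mult_left_mono)
  have "c * d = b * (k * m / (m + k)\<^sup>2 / (2 * sqrt U) * d) * std_normal_density (b * sqrt U)"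
    by (simp add: c_def)
  also have "\<dots> \<le> b * (sqrt ?p - sqrt ?q) * std_normal_density (b * sqrt ?p)"
    using root_gain density assms qp by (intro mult_mono mult_left_mono) auto
  also have "\<dots> = (b * sqrt ?p - b * sqrt ?q) * std_normal_density (b * sqrt ?p)"
    by (simp add: algebra_simps)
  also have "\<dots> \<le> Q_function (b * sqrt ?q) - Q_function (b * sqrt ?p)"
    using assms qp q0 by (intro Q_function_diff_ge) auto
  finally show "Q_function (b * sqrt ?p) + c * d \<le> Q_function (b * sqrt ?q)"
    by simp
qed

text \<open>This covers every \<open>H\<close>, however large. If the SNR drops, it is still of
  order \<open>1 / d\<close>, so the new error itself is \<open>O(d\<^sup>2)\<close>; otherwise
  monotonicity suffices.\<close>

lemma Q_scaled_SNR_loss: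
  assumes "0 < b" "0 \<le> H" "0 < d" "d < 1"
  shows "Q_function (b * sqrt (scaled_SNR m k H d))
    \<le> Q_function (b * sqrt (scaled_SNR m k H 0)) + 3 * ((2 * m + k) / (b\<^sup>2 * m))\<^sup>2 * d\<^sup>2"
proof (cases "scaled_SNR m k H d < scaled_SNR m k H 0")
  case True
  let ?p = "scaled_SNR m k H d" and ?l = "m / ((2 * m + k) * d)"
  have l: "0 < ?l" "?l \<le> ?p"
    using scaled_SNR_loss[OF assms(2-4) True] m k assms by auto
  then have "0 < ?p"
    by linarith
  then have "Q_function (b * sqrt ?p) \<le> 3 / (b * sqrt ?p) ^ 4"
    using assms by (intro Q_function_le_inverse_power4) auto
  also have "(b * sqrt ?p) ^ 4 = (b\<^sup>2 * ?p)\<^sup>2"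
    using \<open>0 < ?p\<close> by (simp add: power_mult_distrib power4_eq_xxxx power2_eq_square)
  also have "3 / (b\<^sup>2 * ?p)\<^sup>2 \<le> 3 / (b\<^sup>2 * ?l)\<^sup>2"
    using l \<open>0 < ?p\<close> assms m k by (intro divide_left_mono power_mono mult_left_mono mult_pos_pos) auto
  also have "\<dots> = 3 * ((2 * m + k) / (b\<^sup>2 * m))\<^sup>2 * d\<^sup>2"
    by (simp add: power_mult_distrib power_divide)
  finally show ?thesis
    using Q_function_nonneg[of "b * sqrt (scaled_SNR m k H 0)"] by linarith
next
  case False
  then have "Q_function (b * sqrt (scaled_SNR m k H d)) \<le> Q_function (b * sqrt (scaled_SNR m k H 0))"
    using assms by (intro Q_function_antimono) auto
  then show ?thesis
    by (simp add: add_increasing2)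
qed

end


section \<open>Averaging over the channel\<close>

text \<open>The events \<open>X \<le> n\<close> cover the space, so they cannot all be null. This
  supplies the bounded range of channel gains on which the improvement is uniform.\<close>

lemma (in prob_space) exists_bound_prob_pos:
  fixes X :: "'a \<Rightarrow> real"
  assumes [measurable]: "X \<in> borel_measurable M"
  obtains R where "0 \<le> R" "0 < prob {\<omega> \<in> space M. X \<omega> \<le> R}"
proof -
  have "\<exists>n::nat. prob {\<omega> \<in> space M. X \<omega> \<le> real n} \<noteq> 0"
  proof (rule ccontr)
    assume "\<nexists>n::nat. prob {\<omega> \<in> space M. X \<omega> \<le> real n} \<noteq> 0"
    then have "emeasure M (\<Union>n::nat. {\<omega> \<in> space M. X \<omega> \<le> real n}) = 0"
      by (intro emeasure_UN_eq_0) (auto simp: emeasure_eq_measure)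
    moreover have "(\<Union>n::nat. {\<omega> \<in> space M. X \<omega> \<le> real n}) = space M"
      using real_arch_simple by auto
    ultimately show False
      using emeasure_space_1 by simp
  qed
  then obtain n :: nat where "prob {\<omega> \<in> space M. X \<omega> \<le> real n} \<noteq> 0"
    by blast
  then show thesis
    by (intro that[of "real n"]) (auto simp: zero_less_measure_iff)
qed

lemma (in prob_space) expectation_Q_scaled_SNR_decreases:
  fixes X :: "'a \<Rightarrow> real"
  assumes X [measurable]: "X \<in> borel_measurable M" and nonneg: "\<And>\<omega>. 0 \<le> X \<omega>"
    and m: "0 < m" and k: "0 < k" and b: "0 < b"
  obtains d where "0 < d" "d < 1"
    "expectation (\<lambda>\<omega>. Q_function (b * sqrt (scaled_SNR m k (X \<omega>) d)))
      < expectation (\<lambda>\<omega>. Q_function (b * sqrt (scaled_SNR m k (X \<omega>) 0)))"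
proof -
  obtain R where R: "0 \<le> R" "0 < prob {\<omega> \<in> space M. X \<omega> \<le> R}"
    using exists_bound_prob_pos[OF X] .
  define A where "A = {\<omega> \<in> space M. X \<omega> \<le> R}"
  have A [measurable]: "A \<in> sets M"
    unfolding A_def by measurable
  obtain c where c: "0 < c" and gain:
    "\<And>H d. 0 \<le> H \<Longrightarrow> H \<le> R \<Longrightarrow> 0 < d \<Longrightarrow> d * (m + R) \<le> m \<Longrightarrow>
      Q_function (b * sqrt (scaled_SNR m k H d)) + c * d
        \<le> Q_function (b * sqrt (scaled_SNR m k H 0))"
    using Q_scaled_SNR_gain[OF m k R(1) b] by blast
  define C where "C = 3 * ((2 * m + k) / (b\<^sup>2 * m))\<^sup>2"
  have C: "0 < C"
    using m k b by (simp add: C_def)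
  \<comment> \<open>The bounds give, in order, \<open>d < 1\<close>, the smallness required by
    \<open>gain\<close>, and a quadratic loss of at most half the expected linear gain.\<close>
  define d where "d = Min {1 / 2, m / (m + R), c * prob A / (2 * C)}"
  have d: "0 < d" "d < 1" "d * (m + R) \<le> m" "d * (2 * C) \<le> c * prob A"
  proof -
    have "d \<le> 1 / 2" "d \<le> m / (m + R)" "d \<le> c * prob A / (2 * C)"
      unfolding d_def by (rule Min_le; simp)+
    then show "d < 1" "d * (m + R) \<le> m" "d * (2 * C) \<le> c * prob A"
      using m R C by (simp_all add: pos_le_divide_eq)
    show "0 < d"
      using m R C c by (simp add: d_def A_def)
  qed
  let ?Q = "\<lambda>e \<omega>. Q_function (b * sqrt (scaled_SNR m k (X \<omega>) e))"
  have [simp]: "integrable M (?Q e)" for e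
    unfolding scaled_SNR_def
    by (intro integrable_const_bound[where B = 1]) (auto simp: Q_function_nonneg Q_function_le_1)
  have [simp]: "integrable M (indicator A :: 'a \<Rightarrow> real)"
    by (intro integrable_real_indicator) (auto simp: less_top[symmetric])
  \<comment> \<open>One integrable bound serves both cases: the loss term is added on
    \<open>A\<close> too, and the gain is counted on \<open>A\<close> only.\<close>
  have "?Q d \<omega> \<le> ?Q 0 \<omega> + (C * d\<^sup>2 - c * d * indicator A \<omega>)" if "\<omega> \<in> space M" for \<omega>
  proof (cases "\<omega> \<in> A")
    case True
    then have "?Q d \<omega> + c * d \<le> ?Q 0 \<omega>"
      using gain[of "X \<omega>" d] nonneg d by (simp add: A_def)
    moreover have "0 \<le> C * d\<^sup>2"
      using C by simp
    ultimately have "?Q d \<omega> \<le> ?Q 0 \<omega> + (C * d\<^sup>2 - c * d)"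
      by linarith
    then show ?thesis
      using True by simp
  next
    case False
    then show ?thesis
      using Q_scaled_SNR_loss[OF m k b nonneg d(1,2)] by (simp add: C_def)
  qed
  then have "expectation (?Q d) \<le> expectation (\<lambda>\<omega>. ?Q 0 \<omega> + (C * d\<^sup>2 - c * d * indicator A \<omega>))"
    by (intro integral_mono Bochner_Integration.integrable_add) auto
  also have "\<dots> = expectation (?Q 0) + (C * d\<^sup>2 - c * d * prob A)"
    by (simp add: prob_space)
  also have "C * d\<^sup>2 - c * d * prob A < 0"
  proof -
    have "d * (d * (2 * C)) \<le> d * (c * prob A)"
      using d by (intro mult_left_mono) auto
    moreover have "0 < C * d\<^sup>2"
      using C d by simp
    ultimately show ?thesis
      by (simp add: power2_eq_square algebra_simps)
  qed
  finally have "expectation (?Q d) < expectation (?Q 0)"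
    by simp
  with d(1,2) show thesis
    by (rule that)
qed

theorem proposition6:
  fixes M :: "'w measure" and h :: "'w \<Rightarrow> complex"
    and xtr :: "complex ^ 'B" and a b sx sw :: real
  assumes "prob_space M" and "h \<in> borel_measurable M"
    and "xtr \<noteq> 0"
    and "sx\<^sup>2 > 0" and "sw\<^sup>2 > 0"
    and "a > 0" and "b > 0"
  shows "\<not> optimal_filter (average_zeroth_order_error M h a b sx sw xtr) (MVU_filter xtr)"
proof
  let ?J = "average_zeroth_order_error M h a b sx sw xtr"
  let ?m = "sw\<^sup>2 / sx\<^sup>2" and ?k = "sw\<^sup>2 / (norm xtr)\<^sup>2"
  let ?S = "\<lambda>d \<omega>. scaled_SNR ?m ?k ((cmod (h \<omega>))\<^sup>2) d"
  interpret prob_space M by fact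
  assume opt: "optimal_filter ?J (MVU_filter xtr)"
  have [measurable]: "h \<in> borel_measurable M" by fact
  have "0 < ?m" "0 < ?k"
    using assms by simp_all
  then obtain d where d: "0 < d" "d < 1" and less:
    "expectation (\<lambda>\<omega>. Q_function (b * sqrt (?S d \<omega>))) < expectation (\<lambda>\<omega>. Q_function (b * sqrt (?S 0 \<omega>)))"
    using expectation_Q_scaled_SNR_decreases[of "\<lambda>\<omega>. (cmod (h \<omega>))\<^sup>2" ?m ?k b] \<open>b > 0\<close> by auto
  have J: "?J (MVU_filter xtr /\<^sub>R (1 - e)) = a * expectation (\<lambda>\<omega>. Q_function (b * sqrt (?S e \<omega>)))"
    if "e < 1" for e
    by (simp add: average_zeroth_order_error_def zeroth_order_error_def
          zeroth_order_SNR_scaled_MVU[OF \<open>xtr \<noteq> 0\<close> that])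
  \<comment> \<open>Writing \<open>1 - 0\<close> makes the MVU filter the member
    \<open>e = 0\<close> of the family, so \<open>J\<close> rewrites both sides.\<close>
  have "?J (MVU_filter xtr /\<^sub>R (1 - d)) < ?J (MVU_filter xtr /\<^sub>R (1 - 0))"
    using less \<open>a > 0\<close> d by (simp only: J zero_less_one mult_less_cancel_left_pos)
  moreover have "MVU_filter xtr /\<^sub>R (1 - d) \<noteq> 0"
    using d \<open>xtr \<noteq> 0\<close> by (simp add: MVU_filter_def)
  with opt have "?J (MVU_filter xtr) \<le> ?J (MVU_filter xtr /\<^sub>R (1 - d))"
    unfolding optimal_filter_def by blast
  ultimately show False
    by simp
qed

end
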